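(* Let $X$ be a locally connected metric space. The following are equivalent: (a) $X$ is a hemicompact space; (b) $C_{kh}(X)$ is first countable.
   Context: $C(X)$ is the set of all continuous functions $X\to\mathbb{R}$. For $A\subseteq X$ and $V\subseteq\mathbb{R}$ put $[A,V]^+=\{f\in C(X): f(A)\subseteq V\}$; for $U\subseteq X$ and $r\in\mathbb{R}$ put $[U,r]^-=\{f\in C(X): f^{-1}(r)\cap U\neq\emptyset\}$. $C_{kh}(X)$ is $C(X)$ with the bi-compact-open topology $kh$, the topology with subbase consisting of all $[A,V]^+$ with $A\subseteq X$ compact and $V\subseteq\mathbb{R}$ open, together with all $[U,r]^-$ with $U\subseteq X$ open and $r\in\mathbb{R}$. A space $X$ is hemicompact if there is a sequence $(K_n)$ of compact subsets of $X$ such that every compact subset of $X$ is contained in some $K_n$. *)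

theory Defs
  imports "HOL-Analysis.Analysis"
begin

text \<open>Functions on a carrier are represented extensionally (equal to \<open>undefined\<close> outside
  \<open>topspace X\<close>), so that equality of elements of \<open>C(X)\<close> is equality on \<open>X\<close>.\<close>

definition real_cfuns :: "'a topology \<Rightarrow> ('a \<Rightarrow> real) set" where
  "real_cfuns X = {f \<in> extensional (topspace X). continuous_map X euclideanreal f}"

text \<open>\<open>hit_all X A V\<close> is the set usually written $[A,V]^+$, and \<open>hit_some X U r\<close> is
  $[U,r]^-$. The preimage in \<open>hit_some\<close> is taken in the whole type; this is harmless
  because \<open>U\<close> is always a subset of \<open>topspace X\<close>.\<close>

definition hit_all :: "'a topology \<Rightarrow> 'a set \<Rightarrow> real set \<Rightarrow> ('a \<Rightarrow> real) set" where
  "hit_all X A V = {f \<in> real_cfuns X. f ` A \<subseteq> V}"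

definition hit_some :: "'a topology \<Rightarrow> 'a set \<Rightarrow> real \<Rightarrow> ('a \<Rightarrow> real) set" where
  "hit_some X U r = {f \<in> real_cfuns X. f -` {r} \<inter> U \<noteq> {}}"

definition bi_compact_open_topology :: "'a topology \<Rightarrow> ('a \<Rightarrow> real) topology" where
  "bi_compact_open_topology X = topology_generated_by
     ({hit_all X A V | A V. compactin X A \<and> open V} \<union> {hit_some X U r | U r. openin X U})"

definition hemicompact_space :: "'a topology \<Rightarrow> bool" where
  "hemicompact_space X \<longleftrightarrow>
     (\<exists>K :: nat \<Rightarrow> 'a set. (\<forall>n. compactin X (K n)) \<and>
        (\<forall>A. compactin X A \<longrightarrow> (\<exists>n. A \<subseteq> K n)))"

lemma topspace_bi_compact_open_topology:
  "topspace (bi_compact_open_topology X) = real_cfuns X"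
proof -
  have "hit_all X {} UNIV = real_cfuns X"
    by (simp add: hit_all_def)
  moreover have "compactin X {}" "open (UNIV :: real set)"
    by simp_all
  ultimately have "real_cfuns X \<in> {hit_all X A V | A V. compactin X A \<and> open V}"
    by blast
  then show ?thesis
    unfolding bi_compact_open_topology_def topology_generated_by_topspace
    by (auto simp: hit_all_def hit_some_def)
qed

end

theory Submission
  imports Defs
begin

text \<open>
  From first countability to hemicompactness, only the constant function \<open>0\<close> is examined. A
  neighbourhood of \<open>0\<close> restricts a function only on finitely many compact sets (from the sets
  \<open>[A, V]\<^sup>+\<close>) and at one point each of finitely many open sets (enough to stay in \<open>[U, 0]\<^sup>-\<close>):
  it contains every continuous function that vanishes on some compact set \<open>K\<close>
  (\<open>bi_compact_open_neighbourhood_compact_support\<close>). A countable base at \<open>0\<close> thus gives countably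
  many compact sets. If \<open>A\<close> is compact, some member of the base lies inside \<open>[A, (-1, 1)]\<^sup>+\<close>, and
  then its \<open>K\<close> contains \<open>A\<close>: otherwise complete regularity yields a function vanishing on \<open>K\<close>
  with value 1 at a point of \<open>A\<close>.

  For the converse let \<open>(K\<^sub>n)\<close> witness hemicompactness. The sets \<open>[A, V]\<^sup>+\<close> cause no trouble, since
  near \<open>f\<close> they are controlled by uniform closeness up to \<open>1/(m+1)\<close> on some \<open>K\<^sub>n\<close>. The
  difficulty is that the sets \<open>[U, r]\<^sup>-\<close> containing \<open>f\<close> involve uncountably many \<open>r\<close>. Let \<open>f x = r\<close>
  with \<open>x \<in> U\<close>, and take a connected neighbourhood \<open>W \<subseteq> U\<close> of \<open>x\<close>. If \<open>f\<close> takes values on both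
  sides of \<open>r\<close> on \<open>W\<close>, then so does every function close to \<open>f\<close> at two points of \<open>W\<close>, and it
  attains \<open>r\<close> on \<open>W\<close> by connectedness (\<open>hit_some_of_near_crossing\<close>); uniform closeness on some
  \<open>K\<^sub>n\<close> suffices again. Otherwise \<open>r\<close> is the maximum or minimum of \<open>f\<close> on every small enough
  neighbourhood of \<open>x\<close>. A metric space that is a countable union of compact sets has a countable base,
  and the suprema and infima of \<open>f\<close> over its members form a countable set, so countably many sets
  \<open>[B, r]\<^sup>-\<close> with \<open>B\<close> in that base deal with this case.
\<close>

section \<open>Local bases of the bi-compact-open topology\<close>

text \<open>Membership of \<open>f\<close> in an open set of a generated topology is witnessed by finitely many
  generators, so finite intersections of a countable family that refines the generators at \<open>f\<close>
  form a local base.\<close>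

lemma countable_local_base_of_subbase:
  assumes "countable \<C>"
    and open_\<C>: "\<And>C. C \<in> \<C> \<Longrightarrow> openin (topology_generated_by \<S>) C \<and> f \<in> C"
    and refine: "\<And>S. S \<in> \<S> \<Longrightarrow> f \<in> S \<Longrightarrow> \<exists>C\<in>\<C>. C \<subseteq> S"
  shows "\<exists>\<B>. countable \<B> \<and> (\<forall>V\<in>\<B>. openin (topology_generated_by \<S>) V) \<and>
    (\<forall>U. openin (topology_generated_by \<S>) U \<and> f \<in> U \<longrightarrow> (\<exists>V\<in>\<B>. f \<in> V \<and> V \<subseteq> U))"
proof -
  \<comment> \<open>The empty family is left out because its intersection is the whole type, which need not be open.\<close>
  define \<B> where "\<B> = Inter ` ({F. finite F \<and> F \<subseteq> \<C>} - {{}})"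
  have "countable \<B>"
    unfolding \<B>_def using countable_Collect_finite_subset[OF \<open>countable \<C>\<close>] by blast
  moreover have "\<forall>V\<in>\<B>. openin (topology_generated_by \<S>) V"
    unfolding \<B>_def using open_\<C> by (auto intro!: openin_Inter)
  moreover have "\<exists>V\<in>\<B>. f \<in> V \<and> V \<subseteq> U" if "generate_topology_on \<S> U" "f \<in> U" for U
    using that
  proof induction
    case Empty
    then show ?case by simp
  next
    case (Int a b)
    then obtain F G where "finite F" "F \<subseteq> \<C>" "F \<noteq> {}" "\<Inter>F \<subseteq> a"
      "finite G" "G \<subseteq> \<C>" "\<Inter>G \<subseteq> b"
      unfolding \<B>_def by auto
    then have "\<Inter>(F \<union> G) \<in> \<B>" "\<Inter>(F \<union> G) \<subseteq> a \<inter> b" "f \<in> \<Inter>(F \<union> G)"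
      unfolding \<B>_def using open_\<C> by blast+
    then show ?case by blast
  next
    case (UN K)
    then obtain k where k: "k \<in> K" "f \<in> k" by blast
    then obtain V where "V \<in> \<B>" "f \<in> V" "V \<subseteq> k"
      using UN.IH by blast
    then show ?case using k(1) by blast
  next
    case (Basis s)
    then obtain C where "C \<in> \<C>" "C \<subseteq> s"
      using refine by blast
    then have "\<Inter>{C} \<in> \<B>" "\<Inter>{C} \<subseteq> s" "f \<in> \<Inter>{C}"
      unfolding \<B>_def using open_\<C> by blast+
    then show ?case by blast
  qed
  ultimately show ?thesis
    by (intro exI[of _ \<B>]) (simp add: openin_topology_generated_by_iff)
qed

lemma openin_bi_compact_open_hit_all:
  "compactin X A \<Longrightarrow> open V \<Longrightarrow> openin (bi_compact_open_topology X) (hit_all X A V)"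
  unfolding bi_compact_open_topology_def by (intro topology_generated_by_Basis) blast

lemma openin_bi_compact_open_hit_some:
  "openin X U \<Longrightarrow> openin (bi_compact_open_topology X) (hit_some X U r)"
  unfolding bi_compact_open_topology_def by (intro topology_generated_by_Basis) blast

text \<open>Closeness to \<open>f\<close> on \<open>K\<close> can be enforced by finitely many sets \<open>[A, V]\<^sup>+\<close>: \<open>f(K)\<close> is totally
  bounded, so \<open>K\<close> splits into finitely many compact pieces on each of which \<open>f\<close> is nearly constant.\<close>

lemma uniform_neighbourhood_on_compact:
  assumes f: "f \<in> real_cfuns X" and K: "compactin X K" and "0 < e"
  shows "\<exists>Q. openin (bi_compact_open_topology X) Q \<and> f \<in> Q \<and>
           (\<forall>g\<in>Q. \<forall>x\<in>K. \<bar>g x - f x\<bar> < e)"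
proof -
  let ?T = "bi_compact_open_topology X"
  \<comment> \<open>On a piece, \<open>f\<close> is within \<open>\<delta>\<close> of a centre \<open>c\<close> and \<open>g\<close> within \<open>2 * \<delta>\<close>; the larger radius
    for \<open>g\<close> leaves room for \<open>f\<close> itself, since the pieces are cut out by closed balls.\<close>
  define \<delta> where "\<delta> = e / 3"
  have "\<delta> > 0" using \<open>0 < e\<close> by (simp add: \<delta>_def)
  have cf: "continuous_map X euclideanreal f"
    using f by (simp add: real_cfuns_def)
  have "compact (f ` K)"
    using image_compactin[OF K cf] by simp
  then obtain P where P: "finite P" "f ` K \<subseteq> (\<Union>c\<in>P. ball c \<delta>)"
    using \<open>\<delta> > 0\<close> unfolding compact_eq_totally_bounded by blast
  define A where "A c = K \<inter> {x \<in> topspace X. f x \<in> cball c \<delta>}" for c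
  define N where "N c = hit_all X (A c) (ball c (2 * \<delta>))" for c
  have "compactin X (A c)" for c
    unfolding A_def
    using closedin_continuous_map_preimage[OF cf, of "cball c \<delta>"]
    by (intro compact_Int_closedin[OF K]) simp
  then have N: "openin ?T (N c)" for c
    unfolding N_def by (simp add: openin_bi_compact_open_hit_all)
  have "f \<in> N c" for c
    using f \<open>\<delta> > 0\<close> by (auto simp: N_def hit_all_def A_def)
  \<comment> \<open>The whole space is inserted so that the intersection is open even if \<open>P\<close> is empty.\<close>
  let ?Q = "\<Inter>(insert (topspace ?T) (N ` P))"
  have "openin ?T ?Q"
    using P N by (intro openin_Inter) auto
  moreover have "f \<in> ?Q"
    using f \<open>\<And>c. f \<in> N c\<close> by (simp add: topspace_bi_compact_open_topology)
  moreover have "\<bar>g x - f x\<bar> < e" if g: "g \<in> ?Q" and x: "x \<in> K" for g x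
  proof -
    obtain c where c: "c \<in> P" "f x \<in> ball c \<delta>"
      using P x by blast
    then have "x \<in> A c"
      using x compactin_subset_topspace[OF K] by (auto simp: A_def)
    moreover have "g \<in> N c"
      using g c by blast
    ultimately have "g x \<in> ball c (2 * \<delta>)"
      unfolding N_def hit_all_def by blast
    with c have "\<bar>c - f x\<bar> < \<delta>" "\<bar>c - g x\<bar> < 2 * \<delta>"
      by (simp_all add: dist_real_def)
    moreover have "e = 3 * \<delta>"
      by (simp add: \<delta>_def)
    ultimately show ?thesis
      by linarith
  qed
  ultimately show ?thesis
    by (intro exI[of _ ?Q] conjI ballI)
qed

text \<open>Crossing a level is stable under small perturbations at two points: \<open>g\<close> is still below \<open>r\<close>
  at \<open>y\<close> and above \<open>r\<close> at \<open>z\<close>, and the intermediate value theorem applies on \<open>W\<close>.\<close>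

lemma hit_some_of_near_crossing:
  fixes f g :: "'a \<Rightarrow> real"
  assumes g: "g \<in> real_cfuns X" and W: "connectedin X W" "W \<subseteq> U"
    and y: "y \<in> W" "\<bar>g y - f y\<bar> < r - f y" and z: "z \<in> W" "\<bar>g z - f z\<bar> < f z - r"
  shows "g \<in> hit_some X U r"
proof -
  have "connected (g ` W)"
    using g connectedin_continuous_map_image[OF _ W(1), of euclideanreal g]
    by (simp add: real_cfuns_def)
  moreover have "g y \<le> r" "r \<le> g z"
    using y(2) z(2) by linarith+
  ultimately have "r \<in> g ` W"
    using y(1) z(1) connectedD_interval[of "g ` W" "g y" "g z" r] by simp
  then show ?thesis
    using g W(2) unfolding hit_some_def by blast
qed

section \<open>From hemicompactness to first countability\<close>

text \<open>The countability of the set of local extreme values of \<open>f\<close> is what makes countably many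
  sets \<open>[B, r]\<^sup>-\<close> enough; at any other value local connectedness turns \<open>[U, r]\<^sup>-\<close> into a condition
  on uniform closeness.\<close>

lemma hemicompact_imp_first_countable_bi_compact_open:
  assumes "second_countable X" and "locally_connected_space X" and "hemicompact_space X"
  shows "first_countable (bi_compact_open_topology X)"
  unfolding first_countable_def topspace_bi_compact_open_topology
proof
  let ?T = "bi_compact_open_topology X"
  fix f assume f: "f \<in> real_cfuns X"
  obtain \<G> where \<G>: "countable \<G>" "\<And>B. B \<in> \<G> \<Longrightarrow> openin X B"
    "\<And>U x. openin X U \<Longrightarrow> x \<in> U \<Longrightarrow> \<exists>B\<in>\<G>. x \<in> B \<and> B \<subseteq> U"
    using assms(1) unfolding second_countable_def by meson
  obtain K :: "nat \<Rightarrow> 'a set" where K: "\<And>n. compactin X (K n)"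
    "\<And>A. compactin X A \<Longrightarrow> \<exists>n. A \<subseteq> K n"
    using assms(3) unfolding hemicompact_space_def by blast
  have "\<exists>Q. openin ?T Q \<and> f \<in> Q \<and> (\<forall>g\<in>Q. \<forall>x\<in>K n. \<bar>g x - f x\<bar> < inverse (real (Suc m)))" for n m
    using uniform_neighbourhood_on_compact[OF f K(1)] by simp
  then obtain N where N: "\<And>n m. openin ?T (N n m)" "\<And>n m. f \<in> N n m"
    "\<And>n m g x. g \<in> N n m \<Longrightarrow> x \<in> K n \<Longrightarrow> \<bar>g x - f x\<bar> < inverse (real (Suc m))"
    by metis
  \<comment> \<open>Contains every local extreme value of \<open>f\<close>; where \<open>f\<close> is unbounded on \<open>B\<close> a junk value enters,
    which does no harm as \<open>E\<close> only has to be countable.\<close>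
  define E where "E = (\<lambda>B. Inf (f ` B)) ` \<G> \<union> (\<lambda>B. Sup (f ` B)) ` \<G>"
  define \<C> where "\<C> = case_prod N ` UNIV \<union> (case_prod (hit_some X) ` (\<G> \<times> E) \<inter> {S. f \<in> S})"
  have "countable \<C>"
    unfolding \<C>_def E_def using \<G>(1) by (intro countable_Un countable_Int1) auto
  moreover have "openin ?T C \<and> f \<in> C" if "C \<in> \<C>" for C
    using that N \<G>(2) openin_bi_compact_open_hit_some by (fastforce simp: \<C>_def)
  moreover have "\<exists>C\<in>\<C>. C \<subseteq> S"
    if S: "S \<in> {hit_all X A V |A V. compactin X A \<and> open V} \<union> {hit_some X U r |U r. openin X U}"
      and fS: "f \<in> S" for S
  proof -
    have near: "\<exists>C\<in>\<C>. \<forall>g\<in>C. g \<in> real_cfuns X \<and> (\<forall>x\<in>A. \<bar>g x - f x\<bar> < e)"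
      if A: "compactin X A" and e: "0 < e" for A and e :: real
    proof -
      obtain n where n: "A \<subseteq> K n" using K(2)[OF A] by blast
      obtain m where m: "inverse (real (Suc m)) < e" using reals_Archimedean[OF e] by blast
      have "N n m \<in> \<C>" unfolding \<C>_def by force
      moreover have "N n m \<subseteq> real_cfuns X"
        using openin_subset[OF N(1)] by (simp add: topspace_bi_compact_open_topology)
      moreover have "\<bar>g x - f x\<bar> < e" if "g \<in> N n m" "x \<in> A" for g x
        using N(3)[OF that(1), of x] n that(2) m by (meson order.strict_trans subsetD)
      ultimately show ?thesis by blast
    qed
    consider A V where "S = hit_all X A V" "compactin X A" "open V"
      | U r where "S = hit_some X U r" "openin X U"
      using S by blast
    then show ?thesis
    proof cases
      case (1 A V)
      have cf: "continuous_map X euclideanreal f" using f by (simp add: real_cfuns_def)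
      have "compact (f ` A)" using image_compactin[OF 1(2) cf] by simp
      moreover have "f ` A \<subseteq> V" using 1 fS by (simp add: hit_all_def)
      ultimately obtain e where e: "e > 0" "(\<Union>c\<in>f ` A. ball c e) \<subseteq> V"
        using compact_subset_open_imp_ball_epsilon_subset 1(3) by metis
      obtain C where C: "C \<in> \<C>" "\<forall>g\<in>C. g \<in> real_cfuns X \<and> (\<forall>x\<in>A. \<bar>g x - f x\<bar> < e)"
        using near[OF 1(2) e(1)] by blast
      have "g x \<in> V" if "g \<in> C" "x \<in> A" for g x
      proof -
        have "\<bar>g x - f x\<bar> < e"
          using C(2) that by blast
        then have "g x \<in> ball (f x) e"
          by (simp add: dist_real_def abs_minus_commute)
        then show ?thesis using e that by blast
      qed
      then show ?thesis using C 1 by (auto simp: hit_all_def)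
    next
      case (2 U r)
      then obtain x where x: "x \<in> U" "f x = r"
        using fS by (auto simp: hit_some_def)
      obtain Q W where W: "openin X Q" "connectedin X W" "x \<in> Q" "Q \<subseteq> W" "W \<subseteq> U"
        using assms(2) 2(2) x(1) unfolding locally_connected_space_def neighbourhood_base_of by meson
      obtain B where B: "B \<in> \<G>" "x \<in> B" "B \<subseteq> Q"
        using \<G>(3) W by blast
      show ?thesis
      proof (cases "\<exists>y\<in>W. \<exists>z\<in>W. f y < r \<and> r < f z")
        case True
        then obtain y z where yz: "y \<in> W" "z \<in> W" "f y < r" "r < f z" by blast
        then have "compactin X {y, z}"
          using connectedin_subset_topspace[OF W(2)] by (auto intro: finite_imp_compactin)
        moreover have "0 < min (r - f y) (f z - r)" using yz by simp
        ultimately obtain C where C: "C \<in> \<C>"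
          "\<forall>g\<in>C. g \<in> real_cfuns X \<and> (\<forall>x\<in>{y,z}. \<bar>g x - f x\<bar> < min (r - f y) (f z - r))"
          using near by blast
        then have "C \<subseteq> S"
          unfolding 2(1) using hit_some_of_near_crossing[OF _ W(2,5)] yz by auto
        then show ?thesis using C by blast
      next
        case False
        \<comment> \<open>On \<open>W\<close>, hence on \<open>B\<close>, the values of \<open>f\<close> stay on one side of \<open>r = f x\<close>.\<close>
        have "r \<in> E"
        proof (cases "\<exists>y\<in>B. f y < r")
          case True
          then have "f v \<le> r" if "v \<in> B" for v
            using that \<open>\<not> (\<exists>y\<in>W. \<exists>z\<in>W. f y < r \<and> r < f z)\<close> B(3) W(4)
            by (meson in_mono not_le)
          then have "Sup (f ` B) = r"
            using B(2) x(2) by (intro cSup_eq_maximum) auto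
          then show ?thesis using B(1) by (auto simp: E_def)
        next
          case False
          then have "Inf (f ` B) = r"
            using B x by (intro cInf_eq_minimum) (auto simp: not_less)
          then show ?thesis using B(1) by (auto simp: E_def)
        qed
        moreover have "f \<in> hit_some X B r" using f B x by (auto simp: hit_some_def)
        ultimately have "hit_some X B r \<in> \<C>" using B(1) by (force simp: \<C>_def)
        moreover have "hit_some X B r \<subseteq> S"
          unfolding 2(1) hit_some_def using B W by blast
        ultimately show ?thesis by blast
      qed
    qed
  qed
  ultimately show "\<exists>\<B>. countable \<B> \<and> (\<forall>V\<in>\<B>. openin ?T V) \<and>
      (\<forall>U. openin ?T U \<and> f \<in> U \<longrightarrow> (\<exists>V\<in>\<B>. f \<in> V \<and> V \<subseteq> U))"
    unfolding bi_compact_open_topology_def by (rule countable_local_base_of_subbase)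
qed

text \<open>Each \<open>K\<^sub>n\<close> has a finite \<open>1/(m+1)\<close>-net for every \<open>m\<close>, and the \<open>K\<^sub>n\<close> cover the space because
  points are compact; so the balls of radius \<open>1/(m+1)\<close> about the net points form a countable base.\<close>

lemma (in Metric_space) hemicompact_imp_second_countable:
  assumes "hemicompact_space mtopology"
  shows "second_countable mtopology"
proof -
  obtain K :: "nat \<Rightarrow> 'a set" where K: "\<And>n. compactin mtopology (K n)"
    "\<And>A. compactin mtopology A \<Longrightarrow> \<exists>n. A \<subseteq> K n"
    using assms unfolding hemicompact_space_def by blast
  have "\<exists>P. finite P \<and> P \<subseteq> K n \<and> K n \<subseteq> (\<Union>x\<in>P. mball x (inverse (real (Suc m))))" for n m
    using compactin_imp_mtotally_bounded[OF K(1)] unfolding mtotally_bounded_def by simp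
  then obtain P where P: "\<And>n m. finite (P n m)"
    "\<And>n m. K n \<subseteq> (\<Union>x\<in>P n m. mball x (inverse (real (Suc m))))"
    by metis
  define \<G> where "\<G> = (\<Union>n. \<Union>m. (\<lambda>c. mball c (inverse (real (Suc m)))) ` P n m)"
  have "countable \<G>"
    unfolding \<G>_def by (intro countable_UN countable_image countableI_type countable_finite[OF P(1)])
  moreover have "\<forall>B\<in>\<G>. openin mtopology B"
    by (auto simp: \<G>_def)
  moreover have "\<exists>B\<in>\<G>. x \<in> B \<and> B \<subseteq> U" if U: "openin mtopology U" "x \<in> U" for U x
  proof -
    obtain r where r: "r > 0" "mball x r \<subseteq> U" and "x \<in> M"
      using U unfolding openin_mtopology by blast
    obtain m where m: "inverse (real (Suc m)) < r / 2"
      using reals_Archimedean[of "r / 2"] r(1) by auto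
    obtain n where "x \<in> K n"
      using K(2)[of "{x}"] \<open>x \<in> M\<close> by auto
    then obtain c where c: "c \<in> P n m" "x \<in> mball c (inverse (real (Suc m)))"
      using P(2) by blast
    have "mball c (inverse (real (Suc m))) \<subseteq> mball x r"
    proof
      fix y assume "y \<in> mball c (inverse (real (Suc m)))"
      with c m show "y \<in> mball x r"
        using triangle[of x c y] commute[of x c] by (auto simp del: of_nat_Suc)
    qed
    then show ?thesis
      using c r unfolding \<G>_def by blast
  qed
  ultimately show ?thesis
    unfolding second_countable_def by blast
qed

section \<open>From first countability to hemicompactness\<close>

text \<open>For the generators, \<open>K = A\<close> works for \<open>[A, V]\<^sup>+\<close>, and a single point of \<open>U\<close> where \<open>f\<close> has
  the value \<open>r\<close> works for \<open>[U, r]\<^sup>-\<close>; finite unions of compact sets take care of intersections.\<close>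

lemma bi_compact_open_neighbourhood_compact_support:
  assumes "openin (bi_compact_open_topology X) Q" and "f \<in> Q"
  shows "\<exists>K. compactin X K \<and> (\<forall>g\<in>real_cfuns X. (\<forall>x\<in>K. g x = f x) \<longrightarrow> g \<in> Q)"
  using openin_topology_generated_by[OF assms(1)[unfolded bi_compact_open_topology_def]] assms(2)
proof induction
  case Empty
  then show ?case by simp
next
  case (Int a b)
  then obtain K L where "compactin X K" "\<forall>g\<in>real_cfuns X. (\<forall>x\<in>K. g x = f x) \<longrightarrow> g \<in> a"
    "compactin X L" "\<forall>g\<in>real_cfuns X. (\<forall>x\<in>L. g x = f x) \<longrightarrow> g \<in> b"
    by blast
  then show ?case
    by (intro exI[of _ "K \<union> L"]) (auto intro: compactin_Un)
next
  case (UN \<K>)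
  then show ?case by (meson UnionE UnionI)
next
  case (Basis s)
  then consider A V where "s = hit_all X A V" "compactin X A" | U r where "s = hit_some X U r" "openin X U"
    by blast
  then show ?case
  proof cases
    case (1 A V)
    then show ?thesis
      using Basis(2) by (intro exI[of _ A]) (auto simp: hit_all_def)
  next
    case (2 U r)
    then obtain x where "x \<in> U" "f x = r" "x \<in> topspace X"
      using Basis(2) openin_subset by (fastforce simp: hit_some_def)
    then show ?thesis
      using 2 by (intro exI[of _ "{x}"]) (auto simp: hit_some_def)
  qed
qed

text \<open>The compact sets attached to a countable base at the zero function witness hemicompactness:
  a point of \<open>A\<close> outside one of them can be separated from it by a continuous function, because
  compact sets are closed.\<close>

lemma first_countable_bi_compact_open_imp_hemicompact:
  assumes "completely_regular_space X" and "Hausdorff_space X"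
    and "first_countable (bi_compact_open_topology X)"
  shows "hemicompact_space X"
proof -
  let ?T = "bi_compact_open_topology X"
  define z :: "'a \<Rightarrow> real" where "z = (\<lambda>x\<in>topspace X. 0)"
  have "continuous_map X euclideanreal z"
    by (rule continuous_map_eq[of _ _ "\<lambda>x. 0"]) (auto simp: z_def)
  then have z: "z \<in> real_cfuns X"
    by (simp add: real_cfuns_def z_def)
  then obtain \<B> where \<B>: "countable \<B>" "\<And>V. V \<in> \<B> \<Longrightarrow> openin ?T V"
    "\<And>U. openin ?T U \<Longrightarrow> z \<in> U \<Longrightarrow> \<exists>V\<in>\<B>. z \<in> V \<and> V \<subseteq> U"
    using assms(3) unfolding first_countable_def topspace_bi_compact_open_topology by meson
  define \<D> where "\<D> = {V \<in> \<B>. z \<in> V}"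
  have "countable \<D>"
    using \<B>(1) by (simp add: \<D>_def)
  have "\<D> \<noteq> {}"
    using \<B>(3)[OF openin_topspace] z unfolding \<D>_def topspace_bi_compact_open_topology by blast
  have "\<exists>K. compactin X K \<and> (\<forall>g\<in>real_cfuns X. (\<forall>x\<in>K. g x = z x) \<longrightarrow> g \<in> V)" if "V \<in> \<D>" for V
    using bi_compact_open_neighbourhood_compact_support[OF \<B>(2)] that by (simp add: \<D>_def)
  then obtain K where K: "\<And>V. V \<in> \<D> \<Longrightarrow> compactin X (K V)"
    "\<And>V g. V \<in> \<D> \<Longrightarrow> g \<in> real_cfuns X \<Longrightarrow> (\<And>x. x \<in> K V \<Longrightarrow> g x = z x) \<Longrightarrow> g \<in> V"
    by metis
  have "\<exists>V\<in>\<D>. A \<subseteq> K V" if A: "compactin X A" for A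
  proof -
    have "openin ?T (hit_all X A {-1<..<1})"
      using A by (simp add: openin_bi_compact_open_hit_all)
    moreover have "z \<in> hit_all X A {-1<..<1}"
      using z compactin_subset_topspace[OF A] by (auto simp: hit_all_def z_def)
    ultimately obtain V where V: "V \<in> \<D>" "V \<subseteq> hit_all X A {-1<..<1}"
      using \<B>(3) unfolding \<D>_def by blast
    have "A \<subseteq> K V"
    proof (rule subsetI, rule ccontr)
      fix x assume x: "x \<in> A" "x \<notin> K V"
      then have xX: "x \<in> topspace X" using compactin_subset_topspace[OF A] by blast
      have "closedin X (K V)"
        using K(1) V(1) assms(2) by (simp add: compactin_imp_closedin)
      then obtain h :: "'a \<Rightarrow> real" where h: "continuous_map X (top_of_set {0..1}) h" "h x = 0" "h ` K V \<subseteq> {1}"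
        using assms(1) xX x(2) unfolding completely_regular_space_def by (meson DiffI)
      define g where "g = (\<lambda>y\<in>topspace X. 1 - h y)"
      have "continuous_map X euclideanreal (\<lambda>y. 1 - h y)"
        using h(1) by (intro continuous_intros) (simp add: continuous_map_in_subtopology)
      then have "continuous_map X euclideanreal g"
        by (rule continuous_map_eq) (simp add: g_def)
      then have "g \<in> real_cfuns X"
        by (simp add: real_cfuns_def g_def)
      moreover have "g y = z y" if "y \<in> K V" for y
        using h(3) that compactin_subset_topspace[OF K(1)[OF V(1)]] by (auto simp: g_def z_def)
      ultimately have "g \<in> hit_all X A {-1<..<1}"
        using K(2) V by blast
      then have "g x < 1"
        using x(1) by (auto simp: hit_all_def)
      then show False
        using xX h(2) by (simp add: g_def)
    qed
    then show ?thesis using V(1) by blast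
  qed
  moreover have "range (from_nat_into \<D>) = \<D>"
    by (rule range_from_nat_into[OF \<open>\<D> \<noteq> {}\<close> \<open>countable \<D>\<close>])
  ultimately have "\<exists>n. A \<subseteq> K (from_nat_into \<D> n)" if "compactin X A" for A
    using that by (metis imageE)
  moreover have "compactin X (K (from_nat_into \<D> n))" for n
    by (rule K(1)[OF from_nat_into[OF \<open>\<D> \<noteq> {}\<close>]])
  ultimately show ?thesis
    unfolding hemicompact_space_def by (intro exI[of _ "\<lambda>n. K (from_nat_into \<D> n)"]) simp
qed

theorem theorem3p5:
  fixes M :: "'a set" and d :: "'a \<Rightarrow> 'a \<Rightarrow> real"
  assumes "Metric_space M d"
    and "locally_connected_space (Metric_space.mtopology M d)"
  shows "hemicompact_space (Metric_space.mtopology M d) \<longleftrightarrow>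
         first_countable (bi_compact_open_topology (Metric_space.mtopology M d))"
proof -
  interpret Metric_space M d by fact
  show ?thesis
  proof
    assume h: "hemicompact_space mtopology"
    show "first_countable (bi_compact_open_topology mtopology)"
      by (rule hemicompact_imp_first_countable_bi_compact_open
          [OF hemicompact_imp_second_countable[OF h] assms(2) h])
  next
    assume "first_countable (bi_compact_open_topology mtopology)"
    then show "hemicompact_space mtopology"
      by (rule first_countable_bi_compact_open_imp_hemicompact
          [OF completely_regular_space_mtopology Hausdorff_space_mtopology])
  qed
qed

end
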